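(* Let $G$ be a finite non-abelian group with center $Z(G)$. Let $$M=\max_{x\in G\setminus Z(G)}|C(x)|-|Z(G)|,$$ let $T$ be the number of maximal cyclic subgroups of $G$, and let $U$ be the number of maximal cyclic subgroups of $G$ that are completely contained in $Z(G)$. Then $$\frac{|G|-|Z(G)|}{M}\le \gamma\bigl(\mathcal{C}^{**}(G)\bigr)\le T-U.$$ Moreover, if $p$ is the least prime divisor of $|G|$, then $\gamma(\mathcal{C}^{**}(G))\ge p+1$.
   Context: For a finite group $G$, the proper commuting graph $\mathcal{C}^{**}(G)$ is the simple graph with vertex set $G\setminus Z(G)$ in which two distinct vertices $x,y$ are adjacent if and only if $xy=yx$. $C(x)$ denotes the centralizer of $x$ in $G$. A dominating set of a finite simple graph with vertex set $V$ is a subset $X\subseteq V$ such that every vertex of $V\setminus X$ is adjacent to some vertex of $X$; the domination number $\gamma$ is the minimum cardinality of a dominating set. A maximal cyclic subgroup is a cyclic subgroup not properly contained in any other cyclic subgroup of $G$. *)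

theory Defs
  imports
    "HOL-Algebra.Elementary_Groups"
    "HOL-Computational_Algebra.Primes"
    "Graph_Theory.Pair_Digraph"
begin

definition centralizer :: "('a, 'b) monoid_scheme \<Rightarrow> 'a \<Rightarrow> 'a set" where
  "centralizer G x = {y \<in> carrier G. x \<otimes>\<^bsub>G\<^esub> y = y \<otimes>\<^bsub>G\<^esub> x}"

definition center :: "('a, 'b) monoid_scheme \<Rightarrow> 'a set" where
  "center G = {z \<in> carrier G. \<forall>x \<in> carrier G. z \<otimes>\<^bsub>G\<^esub> x = x \<otimes>\<^bsub>G\<^esub> z}"

definition cyclic_subgroup :: "'a set \<Rightarrow> ('a, 'b) monoid_scheme \<Rightarrow> bool" where
  "cyclic_subgroup H G \<longleftrightarrow> subgroup H G \<and> cyclic_group (G\<lparr>carrier := H\<rparr>)"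

definition maximal_cyclic_subgroup :: "'a set \<Rightarrow> ('a, 'b) monoid_scheme \<Rightarrow> bool" where
  "maximal_cyclic_subgroup H G \<longleftrightarrow>
     cyclic_subgroup H G \<and> \<not> (\<exists>K. cyclic_subgroup K G \<and> H \<subset> K)"

text \<open>
  A simple graph is represented as in the library, by a digraph with a symmetric and irreflexive
  arc relation: the edge \<open>{x, y}\<close> is the pair of arcs \<open>(x, y)\<close> and \<open>(y, x)\<close>.
\<close>

definition proper_commuting_graph :: "('a, 'b) monoid_scheme \<Rightarrow> 'a pair_pre_digraph" where
  "proper_commuting_graph G =
     \<lparr> pverts = carrier G - center G,
       parcs = {(x, y). x \<in> carrier G - center G \<and> y \<in> carrier G - center G \<and>
                        x \<noteq> y \<and> x \<otimes>\<^bsub>G\<^esub> y = y \<otimes>\<^bsub>G\<^esub> x} \<rparr>"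

lemma pair_graph_proper_commuting_graph:
  assumes "finite (carrier G)"
  shows "pair_graph (proper_commuting_graph G)"
proof -
  have "parcs (proper_commuting_graph G) \<subseteq> carrier G \<times> carrier G"
    by (auto simp: proper_commuting_graph_def)
  then have "finite (parcs (proper_commuting_graph G))"
    using assms by (meson finite_SigmaI finite_subset)
  then show ?thesis
    using assms
    by unfold_locales (auto simp: proper_commuting_graph_def symmetric_def intro!: symI)
qed

definition dominating_set :: "('a, 'b) pre_digraph \<Rightarrow> 'a set \<Rightarrow> bool" where
  "dominating_set \<Gamma> X \<longleftrightarrow>
     X \<subseteq> verts \<Gamma> \<and> (\<forall>v \<in> verts \<Gamma> - X. \<exists>u \<in> X. v \<rightarrow>\<^bsub>\<Gamma>\<^esub> u)"

definition domination_number :: "('a, 'b) pre_digraph \<Rightarrow> nat" where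
  "domination_number \<Gamma> = Min (card ` {X. dominating_set \<Gamma> X})"

end

theory Submission
  imports Defs
begin

text \<open>
  In the proper commuting graph, the closed neighbourhood of a vertex \<open>x\<close> is \<open>C(x) - Z(G)\<close>, a set
  of at most \<open>M\<close> elements. These sets, for \<open>x\<close> in a dominating set \<open>X\<close>, cover \<open>G - Z(G)\<close>, so
  \<open>|G| - |Z(G)| \<le> |X| M\<close>; this is the lower bound (\<open>card_noncentral_le\<close>). For the last claim, the
  centralizer of a non-central element is a proper subgroup, so its index is at least the least
  prime divisor \<open>p\<close> of \<open>|G|\<close>, whence \<open>p (M + |Z(G)|) \<le> |G|\<close> (\<open>least_prime_mult_card_centralizer_le\<close>).
  If \<open>|X| \<le> p\<close>, then \<open>|G| - |Z(G)| \<le> p M \<le> |G| - p |Z(G)|\<close>, which is absurd because \<open>p > 1\<close> and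
  \<open>Z(G)\<close> is not empty.

  For the upper bound, choose a generator of each maximal cyclic subgroup that is not contained in
  the center. A generator is not central, since otherwise all its powers would be, so it is a vertex.
  A vertex \<open>v\<close> lies in some maximal cyclic subgroup, which is not contained in the center because
  \<open>v\<close> is not, and \<open>v\<close> commutes with the generator of that subgroup. Hence the chosen generators form
  a dominating set, and there are at most \<open>T - U\<close> of them
  (\<open>domination_number_le_maximal_cyclic\<close>).
\<close>

section \<open>Domination number\<close>

lemma finite_dominating_sets:
  assumes "finite (verts \<Gamma>)"
  shows "finite {X. dominating_set \<Gamma> X}"
  by (rule finite_subset[of _ "Pow (verts \<Gamma>)"]) (use assms in \<open>auto simp: dominating_set_def\<close>)

lemma domination_number_le_card:
  assumes "finite (verts \<Gamma>)" "dominating_set \<Gamma> X"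
  shows "domination_number \<Gamma> \<le> card X"
  unfolding domination_number_def
  using assms finite_dominating_sets by (intro Min_le) auto

text \<open>The minimum is attained because the set of all vertices is dominating.\<close>

lemma domination_number_attained:
  assumes "finite (verts \<Gamma>)"
  obtains X where "dominating_set \<Gamma> X" "card X = domination_number \<Gamma>"
proof -
  have "dominating_set \<Gamma> (verts \<Gamma>)"
    by (simp add: dominating_set_def)
  then have "domination_number \<Gamma> \<in> card ` {X. dominating_set \<Gamma> X}"
    unfolding domination_number_def
    using finite_dominating_sets[OF assms] by (intro Min_in) auto
  then show ?thesis
    using that by auto
qed

text \<open>
  Adjacency excludes \<open>x\<close> itself, but \<open>x\<close> lies in \<open>C(x)\<close>; so the closed neighbourhood of a vertex is
  the non-central part of its centralizer, and domination becomes a covering condition.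
\<close>

lemma dominating_set_proper_commuting_graph:
  "dominating_set (with_proj (proper_commuting_graph G)) X \<longleftrightarrow>
     X \<subseteq> carrier G - center G \<and> carrier G - center G \<subseteq> (\<Union>x\<in>X. centralizer G x)"
proof -
  let ?V = "carrier G - center G"
  have "dominating_set (with_proj (proper_commuting_graph G)) X \<longleftrightarrow>
      X \<subseteq> ?V \<and> (\<forall>v\<in>?V - X. \<exists>u\<in>X. v \<in> ?V \<and> u \<in> ?V \<and> v \<noteq> u \<and> v \<otimes>\<^bsub>G\<^esub> u = u \<otimes>\<^bsub>G\<^esub> v)"
    by (simp add: dominating_set_def proper_commuting_graph_def)
  also have "\<dots> \<longleftrightarrow> X \<subseteq> ?V \<and> (\<forall>v\<in>?V. \<exists>u\<in>X. u \<otimes>\<^bsub>G\<^esub> v = v \<otimes>\<^bsub>G\<^esub> u)"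
    by (rule conj_cong[OF refl]) (metis DiffD1 DiffD2 DiffI subsetD)
  also have "\<dots> \<longleftrightarrow> X \<subseteq> ?V \<and> ?V \<subseteq> (\<Union>x\<in>X. centralizer G x)"
    by (auto simp: centralizer_def)
  finally show ?thesis .
qed

section \<open>Centralizers and the center\<close>

context group
begin

lemma center_subset_centralizer:
  assumes "x \<in> carrier G"
  shows "center G \<subseteq> centralizer G x"
  using assms by (auto simp: center_def centralizer_def)

lemma one_in_center: "\<one> \<in> center G"
  by (simp add: center_def)

lemma subgroup_centralizer:
  assumes x: "x \<in> carrier G"
  shows "subgroup (centralizer G x) G"
proof (rule subgroupI)
  show "centralizer G x \<subseteq> carrier G"
    by (auto simp: centralizer_def)
  show "centralizer G x \<noteq> {}"
    using x by (auto simp: centralizer_def)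
next
  fix a assume "a \<in> centralizer G x"
  then have a: "a \<in> carrier G" "x \<otimes> a = a \<otimes> x"
    by (auto simp: centralizer_def)
  have "x \<otimes> inv a = inv a \<otimes> (a \<otimes> x) \<otimes> inv a"
    using a x by (simp flip: m_assoc)
  also have "\<dots> = inv a \<otimes> (x \<otimes> a) \<otimes> inv a"
    using a by simp
  also have "\<dots> = inv a \<otimes> x"
    using a(1) x by (simp add: m_assoc)
  finally show "inv a \<in> centralizer G x"
    using a by (simp add: centralizer_def)
next
  fix a b assume "a \<in> centralizer G x" "b \<in> centralizer G x"
  then show "a \<otimes> b \<in> centralizer G x"
    using x unfolding centralizer_def by simp (metis m_assoc)
qed

lemma int_pow_in_centralizer:
  assumes "x \<in> carrier G" "a \<in> centralizer G x"
  shows "a [^] (n::int) \<in> centralizer G x"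
  using assms subgroup_centralizer subgroup_int_pow_closed by blast

text \<open>The center is the intersection of all centralizers, each of which is closed under powers.\<close>

lemma int_pow_in_center:
  assumes "a \<in> center G"
  shows "a [^] (n::int) \<in> center G"
proof -
  have "a [^] n \<in> centralizer G y" if "y \<in> carrier G" for y
    using that assms center_subset_centralizer int_pow_in_centralizer by blast
  then show ?thesis
    using assms by (auto simp: center_def centralizer_def)
qed

section \<open>The lower bounds\<close>

text \<open>
  The center is removed from each centralizer before the sizes are added. This subtracts \<open>|Z(G)|\<close>
  once per element of \<open>X\<close>, and the gain over counting whole centralizers is what makes the same
  estimate strong enough for the bound by the least prime divisor.
\<close>

lemma card_noncentral_le:
  assumes "finite (carrier G)"
    and dom: "dominating_set (with_proj (proper_commuting_graph G)) X"
    and m: "\<And>x. x \<in> carrier G - center G \<Longrightarrow> card (centralizer G x) \<le> m"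
  shows "order G - card (center G) \<le> card X * (m - card (center G))"
proof -
  have X: "X \<subseteq> carrier G - center G"
      and cover: "carrier G - center G \<subseteq> (\<Union>x\<in>X. centralizer G x)"
    using dom by (auto simp: dominating_set_proper_commuting_graph)
  have Z: "center G \<subseteq> carrier G" "finite (center G)"
    using assms(1) by (auto simp: center_def)
  have C: "centralizer G x \<subseteq> carrier G" for x
    by (auto simp: centralizer_def)
  have fin: "finite X"
    using X assms(1) by (auto intro: finite_subset)
  have "order G - card (center G) = card (carrier G - center G)"
    using Z by (simp add: order_def card_Diff_subset)
  also have "\<dots> \<le> card (\<Union>x\<in>X. centralizer G x - center G)"
    using cover fin C assms(1) by (intro card_mono) (auto intro: finite_subset)
  also have "\<dots> \<le> (\<Sum>x\<in>X. card (centralizer G x - center G))"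
    by (rule card_UN_le[OF fin])
  also have "\<dots> \<le> (\<Sum>x\<in>X. m - card (center G))"
  proof (rule sum_mono)
    fix x assume "x \<in> X"
    then have "x \<in> carrier G - center G"
      using X by auto
    then show "card (centralizer G x - center G) \<le> m - card (center G)"
      using Z(2) m center_subset_centralizer by (simp add: card_Diff_subset diff_le_mono)
  qed
  finally show ?thesis
    by simp
qed

text \<open>
  The index of the centralizer exceeds \<open>1\<close>, so it has a prime divisor, and that prime divides
  \<open>|G|\<close> by Lagrange's theorem.
\<close>

lemma least_prime_mult_card_centralizer_le:
  assumes "finite (carrier G)" and x: "x \<in> carrier G - center G"
    and least: "\<And>q. prime q \<Longrightarrow> q dvd order G \<Longrightarrow> p \<le> q"
  shows "p * card (centralizer G x) \<le> order G"
proof -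
  define i where "i = card (rcosets (centralizer G x))"
  have lagr: "i * card (centralizer G x) = order G"
    unfolding i_def using x subgroup_centralizer lagrange by blast
  have pos: "order G > 0"
    using assms(1) order_gt_0_iff_finite by blast
  have "centralizer G x \<subset> carrier G"
    using x by (fastforce simp: centralizer_def center_def)
  then have "card (centralizer G x) < order G"
    using assms(1) unfolding order_def by (rule psubset_card_mono[rotated])
  then have "i \<noteq> 1"
    using lagr by auto
  then obtain q where "prime q" "q dvd i"
    using prime_factor_nat by blast
  moreover have "q dvd order G"
    using \<open>q dvd i\<close> lagr by (metis dvd_mult2)
  moreover have "i > 0"
    using lagr pos by (cases i) auto
  ultimately have "p \<le> i"
    using least dvd_imp_le le_trans by blast
  then show ?thesis
    using lagr by (metis mult_le_mono1)
qed

section \<open>The upper bound\<close>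

lemma cyclic_subgroup_iff_powers:
  "cyclic_subgroup H G \<longleftrightarrow> (\<exists>x\<in>carrier G. H = range (\<lambda>n::int. x [^] n))"
proof
  assume "cyclic_subgroup H G"
  then have H: "subgroup H G" and cyc: "cyclic_group (G\<lparr>carrier := H\<rparr>)"
    by (auto simp: cyclic_subgroup_def)
  interpret H: group "G\<lparr>carrier := H\<rparr>"
    using H by (rule subgroup_imp_group)
  obtain x where "x \<in> H" and x: "H = range (\<lambda>n::int. x [^]\<^bsub>G\<lparr>carrier := H\<rparr>\<^esub> n)"
    using cyc H.cyclic_group by auto
  have "range (\<lambda>n::int. x [^]\<^bsub>G\<lparr>carrier := H\<rparr>\<^esub> n) = range (\<lambda>n::int. x [^] n)"
    by (simp only: int_pow_consistent[OF H \<open>x \<in> H\<close>])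
  then have "H = range (\<lambda>n::int. x [^] n)"
    using x by (rule trans[rotated])
  moreover have "x \<in> carrier G"
    using \<open>x \<in> H\<close> subgroup.subset[OF H] by blast
  ultimately show "\<exists>x\<in>carrier G. H = range (\<lambda>n::int. x [^] n)"
    by (rule rev_bexI[rotated])
next
  assume "\<exists>x\<in>carrier G. H = range (\<lambda>n::int. x [^] n)"
  then obtain x where x: "x \<in> carrier G" and H_eq: "H = range (\<lambda>n::int. x [^] n)"
    by blast
  have H: "subgroup H G"
    unfolding H_eq by (rule subgroup_of_powers[OF x])
  interpret H: group "G\<lparr>carrier := H\<rparr>"
    using H by (rule subgroup_imp_group)
  have "x \<in> H"
    unfolding H_eq by (rule range_eqI[of _ _ 1]) (use x in simp)
  moreover have "H = range (\<lambda>n::int. x [^]\<^bsub>G\<lparr>carrier := H\<rparr>\<^esub> n)"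
  proof -
    have "range (\<lambda>n::int. x [^]\<^bsub>G\<lparr>carrier := H\<rparr>\<^esub> n) = range (\<lambda>n::int. x [^] n)"
      by (simp only: int_pow_consistent[OF H \<open>x \<in> H\<close>])
    with H_eq show ?thesis
      by (rule trans[OF _ sym])
  qed
  ultimately have "cyclic_group (G\<lparr>carrier := H\<rparr>)"
    using H.cyclic_group by auto
  then show "cyclic_subgroup H G"
    using H by (simp add: cyclic_subgroup_def)
qed

lemma finite_cyclic_subgroups:
  assumes "finite (carrier G)"
  shows "finite {H. cyclic_subgroup H G}"
  by (rule finite_subset[of _ "Pow (carrier G)"])
     (use assms subgroup.subset in \<open>auto simp: cyclic_subgroup_def\<close>)

text \<open>Among the finitely many cyclic subgroups, take a maximal one above \<open>\<langle>v\<rangle>\<close>.\<close>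

lemma in_maximal_cyclic_subgroup:
  assumes "finite (carrier G)" and v: "v \<in> carrier G"
  obtains H where "maximal_cyclic_subgroup H G" "v \<in> H"
proof -
  let ?V = "range (\<lambda>n::int. v [^] n)"
  have "?V \<in> {H. cyclic_subgroup H G}"
    using v by (auto simp: cyclic_subgroup_iff_powers)
  from finite_has_maximal2[OF finite_cyclic_subgroups[OF assms(1)] this]
  obtain H where H: "cyclic_subgroup H G" "?V \<subseteq> H"
      and max: "\<forall>K\<in>{H. cyclic_subgroup H G}. H \<subseteq> K \<longrightarrow> H = K"
    by (elim bexE conjE) simp
  have "v \<in> ?V"
    by (rule range_eqI[of _ _ 1]) (use v in simp)
  then have "v \<in> H"
    using H(2) by (rule subsetD[rotated])
  moreover have "maximal_cyclic_subgroup H G"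
    unfolding maximal_cyclic_subgroup_def using H(1) max by (simp add: psubset_eq)
  ultimately show ?thesis
    using that by simp
qed

text \<open>
  The dominating set consists of one generator \<open>g H\<close> for each maximal cyclic subgroup \<open>H\<close> that is
  not contained in the center: \<open>g H\<close> is not central, and its centralizer contains \<open>H\<close>.
\<close>

lemma domination_number_le_maximal_cyclic:
  assumes fin: "finite (carrier G)"
  shows "domination_number (with_proj (proper_commuting_graph G))
           \<le> card {H. maximal_cyclic_subgroup H G \<and> \<not> H \<subseteq> center G}"
proof -
  let ?S = "{H. maximal_cyclic_subgroup H G \<and> \<not> H \<subseteq> center G}"
  have "\<forall>H\<in>?S. \<exists>x. x \<in> carrier G \<and> H = range (\<lambda>n::int. x [^] n)"
    by (simp add: maximal_cyclic_subgroup_def cyclic_subgroup_iff_powers Bex_def)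
  from bchoice[OF this] obtain g
    where "\<forall>H\<in>?S. g H \<in> carrier G \<and> H = range (\<lambda>n::int. g H [^] n)"
    by (elim exE)
  then have g: "g H \<in> carrier G" and pow: "H = range (\<lambda>n::int. g H [^] n)" if "H \<in> ?S" for H
    using that by (blast, blast)
  have "g H \<notin> center G" if "H \<in> ?S" for H
  proof
    assume "g H \<in> center G"
    then have "range (\<lambda>n::int. g H [^] n) \<subseteq> center G"
      using int_pow_in_center by blast
    then have "H \<subseteq> center G"
      by (rule ord_eq_le_trans[OF pow[OF that]])
    then show False
      using that by simp
  qed
  moreover have "\<exists>H\<in>?S. v \<in> centralizer G (g H)" if v: "v \<in> carrier G - center G" for v
  proof -
    obtain H where "maximal_cyclic_subgroup H G" "v \<in> H"
      using v fin in_maximal_cyclic_subgroup by blast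
    then have H: "H \<in> ?S"
      using v by auto
    have "g H \<in> centralizer G (g H)"
      using g[OF H] by (simp add: centralizer_def)
    then have "range (\<lambda>n::int. g H [^] n) \<subseteq> centralizer G (g H)"
      using g[OF H] int_pow_in_centralizer by blast
    then have "H \<subseteq> centralizer G (g H)"
      by (rule ord_eq_le_trans[OF pow[OF H]])
    then show ?thesis
      using H \<open>v \<in> H\<close> by blast
  qed
  ultimately have "dominating_set (with_proj (proper_commuting_graph G)) (g ` ?S)"
    using g by (fastforce simp: dominating_set_proper_commuting_graph)
  then have "domination_number (with_proj (proper_commuting_graph G)) \<le> card (g ` ?S)"
    using fin by (intro domination_number_le_card) (auto simp: proper_commuting_graph_def)
  also have "\<dots> \<le> card ?S"
  proof (rule card_image_le)
    show "finite ?S"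
      using finite_cyclic_subgroups[OF fin]
      by (rule rev_finite_subset) (auto simp: maximal_cyclic_subgroup_def)
  qed
  finally show ?thesis .
qed

end

section \<open>The bounds on the domination number\<close>

theorem theorem1p2:
  fixes G :: "('a, 'b) monoid_scheme"
    and M T U :: real and \<gamma> :: nat
  assumes "group G" and "finite (carrier G)" and "\<not> comm_group G"
  defines "M \<equiv> real (Max {card (centralizer G x) | x. x \<in> carrier G - center G})
                - real (card (center G))"
    and "T \<equiv> real (card {H. maximal_cyclic_subgroup H G})"
    and "U \<equiv> real (card {H. maximal_cyclic_subgroup H G \<and> H \<subseteq> center G})"
    and "\<gamma> \<equiv> domination_number (with_proj (proper_commuting_graph G))"
  shows "(real (order G) - real (card (center G))) / M \<le> real \<gamma>
       \<and> real \<gamma> \<le> T - U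
       \<and> (\<forall>p. prime p \<and> p dvd order G \<and> (\<forall>q. prime q \<and> q dvd order G \<longrightarrow> p \<le> q)
              \<longrightarrow> \<gamma> \<ge> p + 1)"
proof -
  interpret group G by fact
  note fin = assms(2)
  let ?z = "card (center G)"
  let ?A = "{card (centralizer G x) | x. x \<in> carrier G - center G}"
  define m where "m = Max ?A"
  have "carrier G - center G \<noteq> {}"
  proof
    assume "carrier G - center G = {}"
    then have "x \<otimes>\<^bsub>G\<^esub> y = y \<otimes>\<^bsub>G\<^esub> x" if "x \<in> carrier G" "y \<in> carrier G" for x y
      using that unfolding center_def by blast
    then have "comm_group G"
      by (rule group_comm_groupI)
    with assms(3) show False ..
  qed
  then have A: "finite ?A" "?A \<noteq> {}"
    using fin by auto
  then have "m \<in> ?A"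
    unfolding m_def by (rule Max_in)
  then obtain x0 where x0: "x0 \<in> carrier G - center G" and m_eq: "m = card (centralizer G x0)"
    by auto
  have Z: "center G \<subseteq> carrier G"
    by (auto simp: center_def)
  have z_le: "?z \<le> order G"
    unfolding order_def using fin Z by (rule card_mono)
  have z_pos: "?z > 0"
    using one_in_center finite_subset[OF Z fin] card_gt_0_iff by blast
  have "x0 \<in> centralizer G x0"
    using x0 by (simp add: centralizer_def)
  then have "center G \<subset> centralizer G x0"
    using x0 center_subset_centralizer by auto
  then have z_less: "?z < m"
    unfolding m_eq using fin by (intro psubset_card_mono) (auto simp: centralizer_def)
  have "finite (verts (with_proj (proper_commuting_graph G)))"
    using fin by (simp add: proper_commuting_graph_def)
  then obtain X where X: "dominating_set (with_proj (proper_commuting_graph G)) X" "card X = \<gamma>"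
    unfolding \<gamma>_def by (rule domination_number_attained)
  have "card (centralizer G x) \<le> m" if "x \<in> carrier G - center G" for x
    unfolding m_def using A(1) that by (intro Max_ge) auto
  from card_noncentral_le[OF fin X(1) this]
  have low: "order G - ?z \<le> \<gamma> * (m - ?z)"
    using X(2) by simp
  have lower: "(real (order G) - real ?z) / M \<le> real \<gamma>"
  proof -
    have M: "M = real (m - ?z)"
      using z_less by (simp add: M_def m_def of_nat_diff)
    have "real (order G) - real ?z \<le> real \<gamma> * M"
      using low z_le unfolding M by (metis of_nat_diff of_nat_le_iff of_nat_mult)
    then show ?thesis
      using z_less unfolding M by (simp add: pos_divide_le_eq)
  qed
  have upper: "real \<gamma> \<le> T - U"
  proof -
    let ?T = "{H. maximal_cyclic_subgroup H G}"
    let ?U = "{H. maximal_cyclic_subgroup H G \<and> H \<subseteq> center G}"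
    have finT: "finite ?T"
      using finite_cyclic_subgroups[OF fin]
      by (rule rev_finite_subset) (auto simp: maximal_cyclic_subgroup_def)
    have sub: "?U \<subseteq> ?T"
      by auto
    have "{H. maximal_cyclic_subgroup H G \<and> \<not> H \<subseteq> center G} = ?T - ?U"
      by auto
    then have "\<gamma> \<le> card ?T - card ?U"
      using domination_number_le_maximal_cyclic[OF fin]
      by (simp add: \<gamma>_def card_Diff_subset[OF finite_subset[OF sub finT] sub])
    then show ?thesis
      using card_mono[OF finT sub] by (simp add: T_def U_def)
  qed
  \<comment> \<open>If \<open>\<gamma> \<le> p\<close>, the covering estimate gives \<open>|G| - z \<le> p (m - z) \<le> |G| - p z\<close> for \<open>z = |Z(G)| > 0\<close>.\<close>
  have "p + 1 \<le> \<gamma>"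
    if p: "prime p" and least: "\<And>q. prime q \<Longrightarrow> q dvd order G \<Longrightarrow> p \<le> q" for p
  proof (rule ccontr)
    assume "\<not> p + 1 \<le> \<gamma>"
    then have "\<gamma> * (m - ?z) \<le> p * (m - ?z)"
      by (intro mult_le_mono1) simp
    moreover have "p * m \<le> order G"
      unfolding m_eq by (rule least_prime_mult_card_centralizer_le[OF fin x0 least])
    ultimately have "order G - ?z \<le> order G - p * ?z"
      using low by (simp add: diff_mult_distrib2)
    moreover have "?z < p * ?z"
      using prime_gt_1_nat[OF p] z_pos by simp
    moreover have "p * ?z \<le> order G"
      using \<open>p * m \<le> order G\<close> z_less by (meson le_trans less_imp_le mult_le_mono2)
    ultimately show False
      by linarith
  qed
  then show ?thesis
    using lower upper by blast
qed

end
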